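(* Let $(G_n)_{n\ge1}$ and $(G_n')_{n\ge1}$ be two sequences of finite connected graphs with $V(G_n)=V(G_n')$ and $E(G_n')\subseteq E(G_n)$ for all $n$, and let $(\alpha_n)_{n\ge1}$ be a sequence of strictly positive real numbers. Let $f_n\colon\{0,1\}^{V(G_n)}\to\{0,1\}$, $n\ge1$, be a nondegenerate sequence of functions. Then: (i) if $(f_n)_{n\ge1}$ is exclusion sensitive with respect to $(G_n',\alpha_n)_{n\ge1}$, then $(f_n)_{n\ge1}$ is exclusion sensitive with respect to $(G_n,\alpha_n)_{n\ge1}$; (ii) if $(f_n)_{n\ge1}$ is exclusion stable with respect to $(G_n,\alpha_n)_{n\ge1}$, then $(f_n)_{n\ge1}$ is exclusion stable with respect to $(G_n',\alpha_n)_{n\ge1}$.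
   Context: For a finite graph $G$ and $\alpha>0$, the symmetric exclusion process on $\{0,1\}^{V(G)}$ with rate $\alpha$ is the continuous-time Markov chain $(X_t)_{t\ge0}$ defined as follows: each edge $e\in E(G)$ carries an independent Poisson clock of rate $\alpha$, and when the clock of $e$ rings, the values of the configuration at the two endpoints of $e$ are interchanged. Equivalently, its generator is $Qf(x)=\alpha\sum_{e\in E(G)}(f(x_e)-f(x))$, where $x_e$ is obtained from $x$ by interchanging the values at the endpoints of $e$. The process with respect to $(G,\alpha)$ is started from $X_0$ uniformly distributed on $\{0,1\}^{V(G)}$ (which is a stationary distribution). Let $(G_n)_{n\ge1}$ be finite connected graphs, $\alpha_n>0$, and let $X^{(n)}$ be the symmetric exclusion process with respect to $(G_n,\alpha_n)$. A sequence $f_n\colon\{0,1\}^{V(G_n)}\to\{0,1\}$ is exclusion sensitive with respect to $(G_n,\alpha_n)_{n\ge1}$ if $\lim_{n\to\infty}\mathrm{Cov}(f_n(X^{(n)}_0),f_n(X^{(n)}_1))=0$. It is exclusion stable with respect to $(G_n,\alpha_n)_{n\ge1}$ if $\lim_{\varepsilon\to0}\limsup_{n\to\infty}P(f_n(X^{(n)}_0)\neq f_n(X^{(n)}_\varepsilon))=0$. The sequence $(f_n)_{n\ge1}$ is nondegenerate if $\mathrm{Var}(f_n(X_0^{(n)}))$ is bounded away from zero uniformly in $n$. *)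

theory Defs
  imports "HOL-Probability.Probability" "HOL-Combinatorics.Transposition"
begin

text \<open>An edge is the two-element set of its endpoints, so graphs are simple and undirected.\<close>

definition finite_connected_graph :: "'v set \<Rightarrow> 'v set set \<Rightarrow> bool" where
  "finite_connected_graph V E \<longleftrightarrow>
     finite V \<and> V \<noteq> {} \<and> E \<subseteq> {e. e \<subseteq> V \<and> card e = 2} \<and>
     (\<forall>u\<in>V. \<forall>v\<in>V. (u, v) \<in> {(a, b). {a, b} \<in> E}\<^sup>*)"

definition configs :: "'v set \<Rightarrow> ('v \<Rightarrow> nat) set" where
  "configs V = V \<rightarrow>\<^sub>E {0, 1}"

text \<open>For an edge \<open>e\<close> with \<open>w \<in> e\<close>, the other endpoint is the only element of \<open>e - {w}\<close>.\<close>

definition swap_edge :: "'v set \<Rightarrow> ('v \<Rightarrow> nat) \<Rightarrow> 'v \<Rightarrow> nat" where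
  "swap_edge e x = (\<lambda>w. if w \<in> e then x (the_elem (e - {w})) else x w)"

lemma swap_edge_eq_transpose:
  assumes "u \<noteq> v"
  shows "swap_edge {u, v} x = x \<circ> Transposition.transpose u v"
proof
  fix w
  have "{u, v} - {u} = {v}" "{u, v} - {v} = {u}"
    using assms by auto
  then show "swap_edge {u, v} x w = (x \<circ> Transposition.transpose u v) w"
    by (auto simp: swap_edge_def Transposition.transpose_def)
qed

definition exclusion_generator ::
  "'v set set \<Rightarrow> real \<Rightarrow> (('v \<Rightarrow> nat) \<Rightarrow> real) \<Rightarrow> ('v \<Rightarrow> nat) \<Rightarrow> real" where
  "exclusion_generator E \<alpha> g x = \<alpha> * (\<Sum>e\<in>E. g (swap_edge e x) - g x)"

text \<open>The entry \<open>(x, y)\<close> of the matrix exponential \<open>exp (t Q)\<close>, for a generator \<open>Q\<close> given as an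
  operator on functions.\<close>

definition transition_prob ::
  "(('s \<Rightarrow> real) \<Rightarrow> 's \<Rightarrow> real) \<Rightarrow> real \<Rightarrow> 's \<Rightarrow> 's \<Rightarrow> real" where
  "transition_prob Q t x y = (\<Sum>k. t ^ k / fact k * (Q ^^ k) (indicator {y}) x)"

text \<open>\<open>X\<close> is a continuous-time Markov chain on the finite state space \<open>S\<close> with generator \<open>Q\<close>:
  its paths are almost surely right-continuous step functions, and the Markov property holds with
  transition function \<open>exp (t Q)\<close>. The Markov property is multiplied out, so that conditioning
  events of probability zero need no special treatment.\<close>

definition markov_chain_with_generator ::
  "'a measure \<Rightarrow> (real \<Rightarrow> 'a \<Rightarrow> 's) \<Rightarrow> 's set \<Rightarrow> (('s \<Rightarrow> real) \<Rightarrow> 's \<Rightarrow> real) \<Rightarrow> bool" where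
  "markov_chain_with_generator M X S Q \<longleftrightarrow>
     prob_space M \<and>
     (\<forall>t\<ge>0. X t \<in> measurable M (count_space S)) \<and>
     (AE \<omega> in M. \<forall>t\<ge>0. \<forall>\<^sub>F s in at_right t. X s \<omega> = X t \<omega>) \<and>
     (\<forall>m (t :: nat \<Rightarrow> real) x. 0 \<le> t 0 \<and> (\<forall>i\<le>m. t i \<le> t (Suc i)) \<and> (\<forall>i\<le>Suc m. x i \<in> S) \<longrightarrow>
        measure M {\<omega>\<in>space M. \<forall>i\<le>Suc m. X (t i) \<omega> = x i} =
        measure M {\<omega>\<in>space M. \<forall>i\<le>m. X (t i) \<omega> = x i} *
          transition_prob Q (t (Suc m) - t m) (x m) (x (Suc m)))"

definition symmetric_exclusion_process ::
  "'a measure \<Rightarrow> (real \<Rightarrow> 'a \<Rightarrow> 'v \<Rightarrow> nat) \<Rightarrow> 'v set \<Rightarrow> 'v set set \<Rightarrow> real \<Rightarrow> bool" where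
  "symmetric_exclusion_process M X V E \<alpha> \<longleftrightarrow>
     markov_chain_with_generator M X (configs V) (exclusion_generator E \<alpha>) \<and>
     distr M (count_space (configs V)) (X 0) = uniform_count_measure (configs V)"

definition covariance :: "'a measure \<Rightarrow> ('a \<Rightarrow> real) \<Rightarrow> ('a \<Rightarrow> real) \<Rightarrow> real" where
  "covariance M Y Z =
     (\<integral>\<omega>. (Y \<omega> - (\<integral>\<omega>'. Y \<omega>' \<partial>M)) * (Z \<omega> - (\<integral>\<omega>'. Z \<omega>' \<partial>M)) \<partial>M)"

text \<open>Sequences are indexed by \<open>n \<ge> 1\<close>. The graphs and rates enter through the processes: \<open>X n\<close>,
  on the probability space \<open>M n\<close>, is the exclusion process with respect to the \<open>n\<close>-th graph and
  rate, and the quantities below depend only on its law.\<close>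

definition nondegenerate ::
  "(nat \<Rightarrow> 'a measure) \<Rightarrow> (nat \<Rightarrow> real \<Rightarrow> 'a \<Rightarrow> 's) \<Rightarrow> (nat \<Rightarrow> 's \<Rightarrow> real) \<Rightarrow> bool" where
  "nondegenerate M X f \<longleftrightarrow>
     (\<exists>c>0. \<forall>n\<ge>1. c \<le> prob_space.variance (M n) (\<lambda>\<omega>. f n (X n 0 \<omega>)))"

definition exclusion_sensitive ::
  "(nat \<Rightarrow> 'a measure) \<Rightarrow> (nat \<Rightarrow> real \<Rightarrow> 'a \<Rightarrow> 's) \<Rightarrow> (nat \<Rightarrow> 's \<Rightarrow> real) \<Rightarrow> bool" where
  "exclusion_sensitive M X f \<longleftrightarrow>
     (\<lambda>n. covariance (M n) (\<lambda>\<omega>. f n (X n 0 \<omega>)) (\<lambda>\<omega>. f n (X n 1 \<omega>))) \<longlonglongrightarrow> 0"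

definition exclusion_stable ::
  "(nat \<Rightarrow> 'a measure) \<Rightarrow> (nat \<Rightarrow> real \<Rightarrow> 'a \<Rightarrow> 's) \<Rightarrow> (nat \<Rightarrow> 's \<Rightarrow> real) \<Rightarrow> bool" where
  "exclusion_stable M X f \<longleftrightarrow>
     ((\<lambda>\<epsilon>. limsup (\<lambda>n. ereal (measure (M n)
         {\<omega>\<in>space (M n). f n (X n 0 \<omega>) \<noteq> f n (X n \<epsilon> \<omega>)}))) \<longlongrightarrow> 0) (at_right 0)"

end

theory Submission
  imports Defs
begin

text \<open>
  Let \<open>A\<close> and \<open>A'\<close> be the negated generators for \<open>E\<close> and \<open>E' \<subseteq> E\<close>. Comparing Dirichlet forms gives
  \<open>0 \<le> A' \<le> A\<close> as quadratic forms. The exponential is not operator monotone, so this does not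
  compare the semigroups, but the resolvents satisfy \<open>(1 + tA)\<inverse> \<le> (1 + tA')\<inverse>\<close>. For \<open>a, K \<ge> 0\<close>,
  \<open>exp (-a) \<le> 1 / (1 + a) \<le> exp K * exp (-a) + 1 / (1 + K)\<close> and
  \<open>1 - 1 / (1 + a) \<le> 1 - exp (-a) \<le> 2 * (1 - 1 / (1 + a))\<close>,
  and by diagonalisation these hold for \<open>a\<close> replaced by \<open>tA\<close> or \<open>tA'\<close>. Hence
  \<open>Cov \<le> exp K * Cov' + 1 / (1 + K)\<close> for every \<open>K \<ge> 0\<close>, which is sensitivity, and the probability
  of disagreement at any time for \<open>E'\<close> is at most twice that for \<open>E\<close>, which is stability.
\<close>

section \<open>Diagonalisation of symmetric operators\<close>

definition ip :: "'s set \<Rightarrow> ('s \<Rightarrow> real) \<Rightarrow> ('s \<Rightarrow> real) \<Rightarrow> real" where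
  "ip S f g = (\<Sum>x\<in>S. f x * g x)"

lemma ip_commute: "ip S f g = ip S g f"
  by (simp add: ip_def mult.commute)

lemma ip_cong: "(\<And>x. x \<in> S \<Longrightarrow> f x = f' x) \<Longrightarrow> (\<And>x. x \<in> S \<Longrightarrow> g x = g' x) \<Longrightarrow> ip S f g = ip S f' g'"
  by (simp add: ip_def)

lemma ip_add: "ip S (\<lambda>x. f x + g x) h = ip S f h + ip S g h"
  "ip S h (\<lambda>x. f x + g x) = ip S h f + ip S h g"
  by (simp_all add: ip_def algebra_simps sum.distrib)

lemma ip_diff: "ip S (\<lambda>x. f x - g x) h = ip S f h - ip S g h"
  "ip S h (\<lambda>x. f x - g x) = ip S h f - ip S h g"
  by (simp_all add: ip_def algebra_simps sum_subtractf)

lemma ip_scale: "ip S (\<lambda>x. c * f x) h = c * ip S f h" "ip S h (\<lambda>x. c * f x) = c * ip S h f"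
  by (simp_all add: ip_def sum_distrib_left algebra_simps)

lemma ip_sum: "ip S (\<lambda>x. \<Sum>i\<in>I. F i x) h = (\<Sum>i\<in>I. ip S (F i) h)"
  "ip S h (\<lambda>x. \<Sum>i\<in>I. F i x) = (\<Sum>i\<in>I. ip S h (F i))"
  unfolding ip_def by (simp_all add: sum_distrib_left sum_distrib_right, (subst sum.swap, simp)+)

lemma ip_nonneg: "0 \<le> ip S f f"
  by (simp add: ip_def sum_nonneg)

lemma ip_self_eq_0_iff: "finite S \<Longrightarrow> ip S f f = 0 \<longleftrightarrow> (\<forall>x\<in>S. f x = 0)"
  by (simp add: ip_def sum_nonneg_eq_0_iff)

text \<open>Members are functions on the whole type, but distinct members cannot agree on
  \<open>S\<close>: their inner product would be both 1 and 0.\<close>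

definition orthonormal :: "'s set \<Rightarrow> ('s \<Rightarrow> real) set \<Rightarrow> bool" where
  "orthonormal S B \<longleftrightarrow> finite B \<and> (\<forall>u\<in>B. \<forall>v\<in>B. ip S u v = (if u = v then 1 else 0))"

lemma ip_orthonormal_combination:
  assumes "orthonormal S B" "v \<in> B"
  shows "ip S (\<lambda>x. \<Sum>u\<in>B. c u * u x) v = c v"
proof -
  have "ip S (\<lambda>x. \<Sum>u\<in>B. c u * u x) v = (\<Sum>u\<in>B. c u * (if u = v then 1 else 0))"
    unfolding ip_sum ip_scale using assms by (intro sum.cong) (auto simp: orthonormal_def)
  also have "\<dots> = c v"
    using assms by (simp add: orthonormal_def if_distrib[of "\<lambda>z. _ * z"] cong: if_cong)
  finally show ?thesis .
qed

lemma ip_orthonormal_combination2: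
  assumes "orthonormal S B"
  shows "ip S (\<lambda>x. \<Sum>u\<in>B. c u * u x) (\<lambda>x. \<Sum>u\<in>B. d u * u x) = (\<Sum>u\<in>B. c u * d u)"
  unfolding ip_sum(2) ip_scale
  using ip_orthonormal_combination[OF assms] by (intro sum.cong) simp_all

text \<open>The squared norm of \<open>f\<close> minus its projection \<open>?p\<close> onto the
  span of \<open>B\<close> is nonnegative.\<close>

lemma bessel:
  assumes "orthonormal S B"
  shows "(\<Sum>u\<in>B. (ip S f u)\<^sup>2) \<le> ip S f f"
proof -
  let ?p = "\<lambda>x. \<Sum>u\<in>B. ip S f u * u x"
  have fp: "ip S f ?p = (\<Sum>u\<in>B. (ip S f u)\<^sup>2)"
    unfolding ip_sum(2) ip_scale by (simp add: power2_eq_square)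
  have pp: "ip S ?p ?p = (\<Sum>u\<in>B. (ip S f u)\<^sup>2)"
    unfolding ip_orthonormal_combination2[OF assms] by (simp add: power2_eq_square)
  have "0 \<le> ip S (\<lambda>x. f x - ?p x) (\<lambda>x. f x - ?p x)"
    by (rule ip_nonneg)
  also have "\<dots> = ip S f f - (\<Sum>u\<in>B. (ip S f u)\<^sup>2)"
    unfolding ip_diff fp pp ip_commute[of S ?p f] by simp
  finally show ?thesis by simp
qed

text \<open>Bessel's inequality for the indicator of a point \<open>x\<close> bounds the sum of
  \<open>(u x)\<^sup>2\<close> over \<open>B\<close> by 1. Summing over \<open>x\<close> and
  exchanging the sums counts \<open>B\<close>, because each \<open>u\<close> has norm 1.\<close>

lemma card_orthonormal_le:
  assumes "orthonormal S B" "finite S"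
  shows "card B \<le> card S"
proof -
  have "(\<Sum>u\<in>B. (u x)\<^sup>2) \<le> 1" if "x \<in> S" for x
  proof -
    have "ip S (indicator {x}) g = g x" for g
      using that \<open>finite S\<close> by (simp add: ip_def indicator_def if_distrib[of "\<lambda>z. z * _"] cong: if_cong)
    then show ?thesis
      using bessel[OF assms(1), of "indicator {x}"] by simp
  qed
  then have "(\<Sum>x\<in>S. \<Sum>u\<in>B. (u x)\<^sup>2) \<le> (\<Sum>x\<in>S. 1)"
    by (rule sum_mono)
  moreover have "(\<Sum>x\<in>S. \<Sum>u\<in>B. (u x)\<^sup>2) = (\<Sum>u\<in>B. ip S u u)"
    by (subst sum.swap) (simp add: ip_def power2_eq_square)
  moreover have "\<dots> = (\<Sum>u\<in>B. 1)"
    using assms(1) by (intro sum.cong) (auto simp: orthonormal_def)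
  ultimately have "real (card B) \<le> real (card S)"
    by simp
  then show ?thesis by simp
qed

text \<open>Functions are normalised to vanish off \<open>S\<close>, which makes the sphere compact in the product
  topology.\<close>

lemma compact_unit_sphere:
  fixes S :: "'s set"
  assumes "finite S"
  shows "compact {f :: 's \<Rightarrow> real. (\<forall>x. x \<notin> S \<longrightarrow> f x = 0) \<and> ip S f f = 1 \<and> (\<forall>u\<in>B. ip S f u = 0)}"
proof -
  \<comment> \<open>The set is a closed subset of a product of compact intervals: norm 1 forces
    every value on \<open>S\<close> into [-1, 1], and the remaining conditions are equations between
    continuous functions of the coordinates.\<close>
  let ?K = "\<lambda>x. if x \<in> S then {-1..1::real} else {0}"
  let ?C = "{f :: 's \<Rightarrow> real. ip S f f = 1} \<inter> (\<Inter>u\<in>B. {f. ip S f u = 0})"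
  have "compact (PiE UNIV ?K)"
    using compactin_PiE[of "\<lambda>_. euclidean" UNIV ?K]
    by (auto simp: euclidean_product_topology)
  moreover have "closed ?C"
    unfolding ip_def
    by (intro closed_Int closed_INT ballI closed_Collect_eq continuous_intros continuous_on_product_coordinates)
  ultimately have "compact (PiE UNIV ?K \<inter> ?C)"
    by (rule compact_Int_closed)
  also have "PiE UNIV ?K \<inter> ?C = {f. (\<forall>x. x \<notin> S \<longrightarrow> f x = 0) \<and> ip S f f = 1 \<and> (\<forall>u\<in>B. ip S f u = 0)}"
  proof -
    have "f x \<in> {-1..1}" if "ip S f f = 1" "x \<in> S" for f x
    proof -
      have "f x * f x \<le> ip S f f"
        unfolding ip_def using that assms by (intro member_le_sum) auto
      then have "(f x)\<^sup>2 \<le> 1" using that by (simp add: power2_eq_square)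
      then show ?thesis by (simp add: abs_square_le_1 abs_le_iff)
    qed
    then show ?thesis by (auto simp: PiE_def Pi_def split: if_splits)
  qed
  finally show ?thesis .
qed

section \<open>Eigenvectors of symmetric operators\<close>

locale symmetric_kernel_operator =
  fixes S :: "'s set" and Q :: "('s \<Rightarrow> real) \<Rightarrow> 's \<Rightarrow> real" and q :: "'s \<Rightarrow> 's \<Rightarrow> real"
  assumes finite_S: "finite S"
    and kernel: "x \<in> S \<Longrightarrow> Q f x = (\<Sum>y\<in>S. q x y * f y)"
    and kernel_sym: "x \<in> S \<Longrightarrow> y \<in> S \<Longrightarrow> q x y = q y x"
begin

lemma self_adjoint: "ip S (Q f) g = ip S f (Q g)"
proof -
  have "ip S (Q f) g = (\<Sum>x\<in>S. \<Sum>y\<in>S. q x y * f y * g x)"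
    by (simp add: ip_def kernel sum_distrib_right)
  also have "\<dots> = (\<Sum>y\<in>S. \<Sum>x\<in>S. q y x * f y * g x)"
    by (subst sum.swap) (simp add: kernel_sym)
  also have "\<dots> = ip S f (Q g)"
    by (simp add: ip_def kernel sum_distrib_left mult_ac)
  finally show ?thesis .
qed

text \<open>Operators act on functions on the whole type, yet identities such as eigenvector
  equations are known only on \<open>S\<close>; this allows rewriting with them under
  \<open>Q\<close>.\<close>

lemma operator_cong:
  assumes "\<And>y. y \<in> S \<Longrightarrow> f y = g y" "x \<in> S"
  shows "Q f x = Q g x"
  using assms by (simp add: kernel)

lemma operator_add_scale: "x \<in> S \<Longrightarrow> Q (\<lambda>y. f y + c * g y) x = Q f x + c * Q g x"
  by (simp add: kernel sum_distrib_left algebra_simps sum.distrib)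

lemma operator_combination: "x \<in> S \<Longrightarrow> Q (\<lambda>y. \<Sum>i\<in>I. c i * F i y) x = (\<Sum>i\<in>I. c i * Q (F i) x)"
  by (simp add: kernel sum_distrib_left, subst sum.swap, simp add: mult_ac)

lemma power_cong:
  assumes "\<And>y. y \<in> S \<Longrightarrow> f y = g y" "x \<in> S"
  shows "(Q ^^ k) f x = (Q ^^ k) g x"
  using assms(2)
proof (induction k arbitrary: x)
  case (Suc k)
  then show ?case by (auto intro!: operator_cong)
qed (use assms in simp)

lemma power_combination:
  assumes eig: "\<And>i x. i \<in> I \<Longrightarrow> x \<in> S \<Longrightarrow> Q (F i) x = a i * F i x" and "x \<in> S"
  shows "(Q ^^ k) (\<lambda>y. \<Sum>i\<in>I. c i * F i y) x = (\<Sum>i\<in>I. c i * a i ^ k * F i x)"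
  using assms(2)
proof (induction k arbitrary: x)
  case (Suc k)
  have "(Q ^^ Suc k) (\<lambda>y. \<Sum>i\<in>I. c i * F i y) x = Q (\<lambda>y. \<Sum>i\<in>I. (c i * a i ^ k) * F i y) x"
    using Suc by (auto intro!: operator_cong)
  also have "\<dots> = (\<Sum>i\<in>I. (c i * a i ^ k) * (a i * F i x))"
    unfolding operator_combination[OF Suc.prems] using eig Suc.prems by simp
  finally show ?case by (simp add: mult_ac)
qed simp

text \<open>The new eigenvector maximises the quadratic form of \<open>Q\<close> over the unit sphere of the orthogonal
  complement of \<open>B\<close>; the quadratic form \<open>b\<close> below is then nonnegative on that complement
  and vanishes at \<open>v\<close>.\<close>

lemma exists_eigenvector:
  assumes eig: "\<And>u x. u \<in> B \<Longrightarrow> x \<in> S \<Longrightarrow> Q u x = \<nu> u * u x"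
    and "\<forall>u\<in>B. ip S f u = 0" "ip S f f \<noteq> 0"
  obtains v \<mu> where "ip S v v = 1" "\<forall>u\<in>B. ip S v u = 0" "\<And>x. x \<in> S \<Longrightarrow> Q v x = \<mu> * v x"
proof -
  define K where "K = {f :: 's \<Rightarrow> real. (\<forall>x. x \<notin> S \<longrightarrow> f x = 0) \<and> ip S f f = 1 \<and> (\<forall>u\<in>B. ip S f u = 0)}"
  \<comment> \<open>\<open>nz\<close> rescales to norm 1 and cuts off outside \<open>S\<close>, so
    that it maps nonzero elements of the complement of \<open>B\<close> into
    \<open>K\<close>.\<close>
  define nz where "nz g = (\<lambda>x. (1 / sqrt (ip S g g)) * (if x \<in> S then g x else 0))" for g
  have nz: "ip S (nz g) h = (1 / sqrt (ip S g g)) * ip S g h" for g h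
    unfolding nz_def ip_scale by (simp add: ip_def cong: sum.cong)
  have nzK: "nz g \<in> K" if "\<forall>u\<in>B. ip S g u = 0" "ip S g g \<noteq> 0" for g
  proof -
    have "ip S (nz g) (nz g) = 1"
      unfolding nz ip_commute[of S g "nz g"] using that ip_nonneg[of S g]
      by (simp add: real_sqrt_mult_self)
    then show ?thesis using that by (simp add: K_def nz) (simp add: nz_def)
  qed
  have "K \<noteq> {}" using nzK assms by blast
  moreover have "compact K"
    unfolding K_def by (rule compact_unit_sphere[OF finite_S])
  \<comment> \<open>Written through the kernel, the quadratic form is a polynomial in finitely many
    coordinates, so it attains its maximum on the compact \<open>K\<close>.\<close>
  moreover have "continuous_on K (\<lambda>g. \<Sum>x\<in>S. g x * (\<Sum>y\<in>S. q x y * g y))"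
    by (intro continuous_intros continuous_on_subset[OF continuous_on_product_coordinates]) auto
  then have "continuous_on K (\<lambda>g. ip S g (Q g))"
    by (simp add: ip_def kernel cong: sum.cong)
  ultimately obtain v where v: "v \<in> K" "\<And>g. g \<in> K \<Longrightarrow> ip S g (Q g) \<le> ip S v (Q v)"
    using continuous_attains_sup[of K] by blast
  define \<mu> where "\<mu> = ip S v (Q v)"
  define b where "b g = \<mu> * ip S g g - ip S g (Q g)" for g
  have b_nonneg: "0 \<le> b g" if "\<forall>u\<in>B. ip S g u = 0" for g
  proof (cases "ip S g g = 0")
    case True
    then have "\<forall>x\<in>S. g x = 0" using finite_S ip_self_eq_0_iff by blast
    then show ?thesis by (simp add: b_def ip_def)
  next
    case False
    have "ip S (nz g) (Q (nz g)) = (1 / sqrt (ip S g g)) * ip S (Q g) (nz g)"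
      unfolding nz self_adjoint by simp
    also have "\<dots> = (1 / sqrt (ip S g g)) * (1 / sqrt (ip S g g)) * ip S g (Q g)"
      unfolding ip_commute[of S "Q g" "nz g"] nz by simp
    also have "\<dots> = ip S g (Q g) / ip S g g"
      using ip_nonneg[of S g] by (simp add: real_sqrt_mult_self)
    finally have "ip S g (Q g) / ip S g g \<le> \<mu>"
      using v(2)[OF nzK[OF that False]] by (simp add: \<mu>_def)
    moreover have "0 < ip S g g" using False ip_nonneg[of S g] by simp
    ultimately show ?thesis by (simp add: b_def divide_le_eq)
  qed
  \<comment> \<open>The residual of the eigenvector equation for \<open>v\<close>. It is again
    orthogonal to \<open>B\<close>, so \<open>b\<close> is nonnegative along the whole line
    \<open>v + t * w\<close>.\<close>
  define w where "w x = Q v x + (- \<mu>) * v x" for x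
  have v1: "ip S v v = 1" and vB: "\<forall>u\<in>B. ip S v u = 0" using v by (auto simp: K_def)
  have wB: "\<forall>u\<in>B. ip S w u = 0"
  proof
    fix u assume "u \<in> B"
    have "ip S v (Q u) = ip S v (\<lambda>x. \<nu> u * u x)"
      using eig[OF \<open>u \<in> B\<close>] by (intro ip_cong) auto
    then show "ip S w u = 0"
      unfolding w_def ip_add ip_scale self_adjoint using vB \<open>u \<in> B\<close> by (simp add: ip_scale)
  qed
  have bv: "b v = 0" by (simp add: b_def \<mu>_def v1)
  \<comment> \<open>As \<open>b v = 0\<close>, only the linear and quadratic terms in
    \<open>t\<close> remain; the linear coefficient is -2 times the squared norm of
    \<open>w\<close>.\<close>
  have expand: "b (\<lambda>x. v x + t * w x) = t * (t * b w - 2 * ip S w w)" for t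
  proof -
    have "ip S g (Q (\<lambda>x. v x + t * w x)) = ip S g (Q v) + t * ip S g (Q w)" for g
      by (subst ip_cong[OF refl operator_add_scale]) (auto simp: ip_add ip_scale)
    moreover have "ip S v (Q w) = ip S w (Q v)"
      using ip_commute[of S v "Q w"] self_adjoint by simp
    ultimately have "b (\<lambda>x. v x + t * w x) =
        b v + 2 * t * (\<mu> * ip S w v - ip S w (Q v)) + t\<^sup>2 * b w"
      unfolding b_def ip_add ip_scale ip_commute[of S v w]
      by (simp add: algebra_simps power2_eq_square)
    moreover have "ip S w (\<lambda>x. Q v x + (- \<mu>) * v x) = ip S w (Q v) + (- \<mu>) * ip S w v"
      by (simp only: ip_add ip_scale)
    then have "\<mu> * ip S w v - ip S w (Q v) = - ip S w w"
      by (simp add: w_def[abs_def])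
    ultimately show ?thesis by (simp only: bv) (simp add: algebra_simps power2_eq_square)
  qed
  have "ip S w w = 0"
  proof (rule ccontr)
    assume "ip S w w \<noteq> 0"
    then have pos: "0 < ip S w w" using ip_nonneg[of S w] by simp
    \<comment> \<open>A positive step so small that the linear term dominates and \<open>b\<close>
      becomes negative; the added 1 keeps the denominator positive when
      \<open>b w = 0\<close>.\<close>
    define t where "t = ip S w w / (b w + 1)"
    have bw: "0 \<le> b w" using b_nonneg wB by blast
    have "0 < t" using pos bw by (simp add: t_def)
    have "t * b w \<le> ip S w w"
      using pos bw by (simp add: t_def field_simps)
    then have "b (\<lambda>x. v x + t * w x) < 0"
      unfolding expand using pos \<open>0 < t\<close> by (simp add: mult_pos_neg)
    moreover have "\<forall>u\<in>B. ip S (\<lambda>x. v x + t * w x) u = 0"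
      using vB wB by (simp add: ip_add ip_scale)
    ultimately show False using b_nonneg by fastforce
  qed
  then have "\<And>x. x \<in> S \<Longrightarrow> Q v x = \<mu> * v x"
    using finite_S by (simp add: ip_self_eq_0_iff w_def)
  then show thesis using that v1 vB by blast
qed

theorem spectral_theorem:
  obtains B \<nu> where "orthonormal S B" "\<And>u x. u \<in> B \<Longrightarrow> x \<in> S \<Longrightarrow> Q u x = \<nu> u * u x"
    "\<And>f x. x \<in> S \<Longrightarrow> f x = (\<Sum>u\<in>B. ip S f u * u x)"
proof -
  let ?P = "\<lambda>B. orthonormal S B \<and> (\<forall>u\<in>B. \<exists>a. \<forall>x\<in>S. Q u x = a * u x)"
  \<comment> \<open>A largest orthonormal set of eigenvectors exists because its size is at most \<open>card S\<close>.\<close>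
  have "?P {}" by (simp add: orthonormal_def)
  then obtain B where B: "?P B" "\<And>B'. ?P B' \<Longrightarrow> card B' \<le> card B"
    using ex_has_greatest_nat[of ?P "{}" card "Suc (card S)"]
      card_orthonormal_le[OF _ finite_S] less_Suc_eq_le by blast
  then obtain \<nu> where \<nu>: "\<And>u x. u \<in> B \<Longrightarrow> x \<in> S \<Longrightarrow> Q u x = \<nu> u * u x"
    by metis
  have on: "orthonormal S B" using B by blast
  have "f x = (\<Sum>u\<in>B. ip S f u * u x)" if "x \<in> S" for f x
  proof -
    \<comment> \<open>If the part of \<open>f\<close> not captured by \<open>B\<close> were nonzero,
      its existence would yield one more eigenvector orthogonal to \<open>B\<close>, against
      maximality.\<close>
    define r where "r x = f x - (\<Sum>u\<in>B. ip S f u * u x)" for x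
    have rB: "\<forall>u\<in>B. ip S r u = 0"
      unfolding r_def[abs_def] ip_diff using ip_orthonormal_combination[OF on] by simp
    have "ip S r r = 0"
    proof (rule ccontr)
      assume "ip S r r \<noteq> 0"
      then obtain v \<mu> where v: "ip S v v = 1" "\<forall>u\<in>B. ip S v u = 0" "\<And>x. x \<in> S \<Longrightarrow> Q v x = \<mu> * v x"
        using exists_eigenvector[of B \<nu> r] \<nu> rB by blast
      have "v \<notin> B" using v by force
      have vB: "ip S u v = 0" if "u \<in> B" for u
        using v(2) that by (subst ip_commute) blast
      have "orthonormal S (insert v B)"
        unfolding orthonormal_def
      proof (intro conjI ballI)
        show "finite (insert v B)" using on by (simp add: orthonormal_def)
        fix a b assume ab: "a \<in> insert v B" "b \<in> insert v B"
        consider "a = v" "b = v" | "a = v" "b \<in> B" | "a \<in> B" "b = v" | "a \<in> B" "b \<in> B"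
          using ab by blast
        then show "ip S a b = (if a = b then 1 else 0)"
        proof cases
          case 4
          then show ?thesis using on unfolding orthonormal_def by blast
        qed (use v(1,2) vB \<open>v \<notin> B\<close> in auto)
      qed
      moreover have "\<forall>u\<in>insert v B. \<exists>a. \<forall>x\<in>S. Q u x = a * u x"
        using B(1) v(3) by blast
      ultimately show False
        using B(2)[of "insert v B"] on \<open>v \<notin> B\<close> by (simp add: orthonormal_def)
    qed
    then show ?thesis
      using that finite_S by (simp add: ip_self_eq_0_iff r_def)
  qed
  then show thesis using that on \<nu> by blast
qed

end

section \<open>Semigroup and resolvent forms\<close>

text \<open>The eigenbasis is a parameter, so that the generators of two graphs can be interpreted
  side by side, each with its own basis. \<open>nonpos\<close> is negative semidefiniteness and
  \<open>const\<close> is conservation of probability.\<close>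

locale diagonalised_generator = symmetric_kernel_operator +
  fixes B :: "('a \<Rightarrow> real) set" and \<nu> :: "('a \<Rightarrow> real) \<Rightarrow> real"
  assumes orthonormal_B: "orthonormal S B"
    and eigen: "u \<in> B \<Longrightarrow> x \<in> S \<Longrightarrow> Q u x = \<nu> u * u x"
    and expansion: "x \<in> S \<Longrightarrow> f x = (\<Sum>u\<in>B. ip S f u * u x)"
    and nonpos: "u \<in> B \<Longrightarrow> \<nu> u \<le> 0"
    and const: "x \<in> S \<Longrightarrow> Q (\<lambda>_. 1) x = 0"
begin

section \<open>Spectral formulas for the transition function\<close>

lemma ip_eigenvector:
  assumes "u \<in> B"
  shows "ip S (Q f) u = \<nu> u * ip S f u"
proof -
  have "ip S f (Q u) = ip S f (\<lambda>x. \<nu> u * u x)"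
    using eigen[OF assms] by (intro ip_cong) auto
  then show ?thesis by (simp add: self_adjoint ip_scale)
qed

lemma parseval: "ip S f g = (\<Sum>u\<in>B. ip S f u * ip S g u)"
proof -
  have "ip S f g = ip S (\<lambda>x. \<Sum>u\<in>B. ip S f u * u x) (\<lambda>x. \<Sum>u\<in>B. ip S g u * u x)"
    using expansion by (intro ip_cong) auto
  then show ?thesis by (simp add: ip_orthonormal_combination2[OF orthonormal_B])
qed

text \<open>Expand the indicator of \<open>y\<close> in eigenvectors: \<open>Q ^^ k\<close>
  multiplies each term by \<open>\<nu> u ^ k\<close>, and the series over \<open>k\<close> becomes
  an exponential for each \<open>u\<close>.\<close>

lemma transition_prob_spectral:
  assumes "x \<in> S" "y \<in> S"
  shows "transition_prob Q t x y = (\<Sum>u\<in>B. u x * u y * exp (t * \<nu> u))"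
proof -
  have ind: "ip S (indicator {y}) u = u y" for u
    using assms finite_S by (simp add: ip_def indicator_def if_distrib[of "\<lambda>z. z * _"] cong: if_cong)
  have "(Q ^^ k) (indicator {y}) x = (\<Sum>u\<in>B. u y * \<nu> u ^ k * u x)" for k
  proof -
    have "(Q ^^ k) (indicator {y}) x = (Q ^^ k) (\<lambda>z. \<Sum>u\<in>B. u y * u z) x"
      using assms(1) expansion[of _ "indicator {y}"] by (intro power_cong) (simp_all add: ind)
    then show ?thesis
      using power_combination[of B "\<lambda>u. u" \<nu> x k "\<lambda>u. u y"] eigen assms(1) by simp
  qed
  then have "transition_prob Q t x y = (\<Sum>k. \<Sum>u\<in>B. u x * u y * ((t * \<nu> u) ^ k / fact k))"
    unfolding transition_prob_def
    by (simp add: sum_distrib_left power_mult_distrib mult_ac sum_divide_distrib)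
  moreover have "(\<lambda>k. \<Sum>u\<in>B. u x * u y * ((t * \<nu> u) ^ k / fact k)) sums
      (\<Sum>u\<in>B. u x * u y * exp (t * \<nu> u))"
    by (intro sums_sum sums_mult) (use exp_converges[where 'a = real] in \<open>simp add: divide_inverse_commute\<close>)
  ultimately show ?thesis by (simp add: sums_iff)
qed

lemma transition_prob_sym: "x \<in> S \<Longrightarrow> y \<in> S \<Longrightarrow> transition_prob Q t x y = transition_prob Q t y x"
  by (simp add: transition_prob_spectral mult_ac)

text \<open>The left side is the inner product of \<open>f\<close> with exp(tQ) applied to
  \<open>g\<close>.\<close>

lemma semigroup_form_spectral:
  "(\<Sum>x\<in>S. \<Sum>y\<in>S. f x * g y * transition_prob Q t x y) =
     (\<Sum>u\<in>B. ip S f u * ip S g u * exp (t * \<nu> u))"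
proof -
  have "(\<Sum>x\<in>S. \<Sum>y\<in>S. f x * g y * transition_prob Q t x y) =
      (\<Sum>x\<in>S. \<Sum>y\<in>S. \<Sum>u\<in>B. (f x * u x) * (g y * u y) * exp (t * \<nu> u))"
    by (simp add: transition_prob_spectral sum_distrib_left mult_ac)
  also have "\<dots> = (\<Sum>u\<in>B. \<Sum>x\<in>S. \<Sum>y\<in>S. (f x * u x) * (g y * u y) * exp (t * \<nu> u))"
    by (subst sum.swap[of _ B], subst sum.swap[of _ B], simp)
  also have "\<dots> = (\<Sum>u\<in>B. ip S f u * ip S g u * exp (t * \<nu> u))"
    unfolding ip_def sum_product unfolding sum_distrib_right ..
  finally show ?thesis .
qed

text \<open>Since \<open>Q\<close> annihilates constants, the constant 1 has zero coefficient on
  every eigenvector with nonzero eigenvalue, so the semigroup fixes it.\<close>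

lemma transition_prob_row_sum:
  assumes "x \<in> S"
  shows "(\<Sum>y\<in>S. transition_prob Q t x y) = 1"
proof -
  have fixed: "ip S (\<lambda>_. 1) u * exp (t * \<nu> u) = ip S (\<lambda>_. 1) u" if "u \<in> B" for u
  proof -
    have "ip S (Q (\<lambda>_. 1)) u = ip S (\<lambda>_. 0) u"
      using const by (intro ip_cong) auto
    then have "\<nu> u * ip S (\<lambda>_. 1) u = 0"
      using ip_eigenvector[OF that] by (simp add: ip_def)
    then show ?thesis by auto
  qed
  have "(\<Sum>y\<in>S. transition_prob Q t x y) = (\<Sum>u\<in>B. u x * (ip S (\<lambda>_. 1) u * exp (t * \<nu> u)))"
    using assms by (simp add: transition_prob_spectral ip_def sum_distrib_left sum_distrib_right mult_ac)
      (subst sum.swap, simp)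
  also have "\<dots> = (\<Sum>u\<in>B. ip S (\<lambda>_. 1) u * u x)"
    using fixed by (intro sum.cong) simp_all
  finally show ?thesis using expansion[OF assms, of "\<lambda>_. 1"] by simp
qed

lemma transition_prob_column_sum: "y \<in> S \<Longrightarrow> (\<Sum>x\<in>S. transition_prob Q t x y) = 1"
  using transition_prob_row_sum[of y t] transition_prob_sym by simp

text \<open>Expand the square. Row and column sums are 1, so both pure squares give
  \<open>ip S f f\<close>, and the cross term is the semigroup form.\<close>

lemma mean_square_increment:
  "(\<Sum>x\<in>S. \<Sum>y\<in>S. (f x - f y)\<^sup>2 * transition_prob Q t x y) =
     2 * (\<Sum>u\<in>B. (ip S f u)\<^sup>2 * (1 - exp (t * \<nu> u)))"
proof -
  let ?p = "transition_prob Q t"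
  have "(\<Sum>x\<in>S. \<Sum>y\<in>S. (f x - f y)\<^sup>2 * ?p x y) =
      (\<Sum>x\<in>S. \<Sum>y\<in>S. (f x)\<^sup>2 * ?p x y) + (\<Sum>x\<in>S. \<Sum>y\<in>S. (f y)\<^sup>2 * ?p x y)
        - 2 * (\<Sum>x\<in>S. \<Sum>y\<in>S. f x * f y * ?p x y)"
    unfolding sum_distrib_left sum.distrib[symmetric] sum_subtractf[symmetric]
    by (intro sum.cong) (simp_all add: power2_diff algebra_simps)
  also have "(\<Sum>x\<in>S. \<Sum>y\<in>S. (f x)\<^sup>2 * ?p x y) = ip S f f"
    by (simp add: sum_distrib_left[symmetric] transition_prob_row_sum ip_def power2_eq_square)
  also have "(\<Sum>x\<in>S. \<Sum>y\<in>S. (f y)\<^sup>2 * ?p x y) = ip S f f"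
    by (subst sum.swap)
      (simp add: sum_distrib_left[symmetric] transition_prob_column_sum ip_def power2_eq_square)
  finally show ?thesis
    unfolding semigroup_form_spectral parseval[of f f]
    by (simp add: right_diff_distrib sum_subtractf power2_eq_square)
qed

text \<open>The quadratic form of the resolvent, the inverse of 1 - tQ, evaluated at
  \<open>f\<close> in the eigenbasis.\<close>

definition resolvent_form :: "real \<Rightarrow> ('a \<Rightarrow> real) \<Rightarrow> real" where
  "resolvent_form t f = (\<Sum>u\<in>B. (ip S f u)\<^sup>2 / (1 - t * \<nu> u))"

text \<open>The left side does not mention the eigenbasis and can be compared between operators; the
  right side decouples into one quadratic polynomial per eigenvector.\<close>

lemma variational_functional:
  "2 * ip S f h - ip S h h + t * ip S h (Q h) =
     (\<Sum>u\<in>B. 2 * ip S f u * ip S h u - (1 - t * \<nu> u) * (ip S h u)\<^sup>2)"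
proof -
  have "ip S h (Q h) = (\<Sum>u\<in>B. \<nu> u * (ip S h u)\<^sup>2)"
    unfolding parseval[of h "Q h"] by (simp add: ip_eigenvector power2_eq_square mult_ac)
  then show ?thesis
    by (simp add: parseval[of f h] parseval[of h h] sum_distrib_left sum.distrib sum_subtractf
        algebra_simps power2_eq_square)
qed

lemma one_minus_pos: "u \<in> B \<Longrightarrow> 0 \<le> t \<Longrightarrow> 0 < 1 - t * \<nu> u"
  using nonpos[of u] mult_nonneg_nonpos[of t "\<nu> u"] by simp

text \<open>Complete the square in each eigencoordinate; the leading coefficient
  \<open>1 - t * \<nu> u\<close> is positive.\<close>

lemma resolvent_form_ge:
  assumes "0 \<le> t"
  shows "2 * ip S f h - ip S h h + t * ip S h (Q h) \<le> resolvent_form t f"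
  unfolding variational_functional resolvent_form_def
proof (rule sum_mono)
  fix u assume "u \<in> B"
  define a where "a = 1 - t * \<nu> u"
  have "0 < a" using one_minus_pos[OF \<open>u \<in> B\<close> assms] by (simp add: a_def)
  have "0 \<le> (ip S f u - a * ip S h u)\<^sup>2 / a" using \<open>0 < a\<close> by simp
  also have "\<dots> = (ip S f u)\<^sup>2 / a - (2 * ip S f u * ip S h u - a * (ip S h u)\<^sup>2)"
    using \<open>0 < a\<close> by (simp add: field_simps power2_eq_square)
  finally show "2 * ip S f u * ip S h u - (1 - t * \<nu> u) * (ip S h u)\<^sup>2 \<le> (ip S f u)\<^sup>2 / (1 - t * \<nu> u)"
    by (simp add: a_def)
qed

lemma resolvent_form_attained:
  assumes "0 \<le> t"
  obtains h where "resolvent_form t f = 2 * ip S f h - ip S h h + t * ip S h (Q h)"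
proof -
  \<comment> \<open>The maximiser is the resolvent applied to \<open>f\<close>, which makes every
    completed square vanish.\<close>
  define h where "h x = (\<Sum>u\<in>B. ip S f u / (1 - t * \<nu> u) * u x)" for x
  have "ip S h u = ip S f u / (1 - t * \<nu> u)" if "u \<in> B" for u
    unfolding h_def by (rule ip_orthonormal_combination[OF orthonormal_B that])
  then have "(ip S f u)\<^sup>2 / (1 - t * \<nu> u) = 2 * ip S f u * ip S h u - (1 - t * \<nu> u) * (ip S h u)\<^sup>2"
    if "u \<in> B" for u
    using that one_minus_pos[OF that assms] by (simp add: power2_eq_square)
  then have "resolvent_form t f = 2 * ip S f h - ip S h h + t * ip S h (Q h)"
    unfolding variational_functional resolvent_form_def by (rule sum.cong[OF refl])
  then show thesis using that by blast
qed

section \<open>Two-sided comparison of semigroup and resolvent forms\<close>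

lemma semigroup_form_nonneg: "0 \<le> (\<Sum>x\<in>S. \<Sum>y\<in>S. f x * f y * transition_prob Q t x y)"
  unfolding semigroup_form_spectral by (intro sum_nonneg) (simp flip: power2_eq_square)

lemma semigroup_form_le_resolvent_form:
  assumes "0 \<le> t"
  shows "(\<Sum>x\<in>S. \<Sum>y\<in>S. f x * f y * transition_prob Q t x y) \<le> resolvent_form t f"
  unfolding semigroup_form_spectral resolvent_form_def
proof (rule sum_mono)
  fix u assume "u \<in> B"
  \<comment> \<open>With \<open>a = - (t * \<nu> u)\<close> this is
    \<open>1 + a \<le> exp a\<close>, inverted.\<close>
  have "exp (t * \<nu> u) \<le> 1 / (1 - t * \<nu> u)"
    using exp_ge_add_one_self[of "- (t * \<nu> u)"] one_minus_pos[OF \<open>u \<in> B\<close> assms]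
    by (simp add: exp_minus field_simps)
  then have "(ip S f u)\<^sup>2 * exp (t * \<nu> u) \<le> (ip S f u)\<^sup>2 * (1 / (1 - t * \<nu> u))"
    by (rule mult_left_mono) simp
  then show "ip S f u * ip S f u * exp (t * \<nu> u) \<le> (ip S f u)\<^sup>2 / (1 - t * \<nu> u)"
    by (simp add: power2_eq_square)
qed

lemma resolvent_form_le_semigroup_form:
  assumes "0 \<le> t" "0 \<le> K"
  shows "resolvent_form t f \<le>
    exp K * (\<Sum>x\<in>S. \<Sum>y\<in>S. f x * f y * transition_prob Q t x y) + ip S f f / (1 + K)"
proof -
  have "(ip S f u)\<^sup>2 / (1 - t * \<nu> u) \<le>
      exp K * ((ip S f u)\<^sup>2 * exp (t * \<nu> u)) + (ip S f u)\<^sup>2 / (1 + K)" if "u \<in> B" for u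
  proof -
    define a where "a = - (t * \<nu> u)"
    have "0 \<le> a" using nonpos[OF that] assms(1) by (simp add: a_def mult_nonneg_nonpos)
    have "1 / (1 + a) \<le> exp K * exp (- a) + 1 / (1 + K)"
    \<comment> \<open>Split the spectrum at \<open>K\<close>: on slow modes
      \<open>exp (K - a)\<close> is at least 1, and on fast modes the resolvent factor is already at
      most \<open>1 / (1 + K)\<close>.\<close>
    proof (cases "a \<le> K")
      case True
      then have "1 \<le> exp K * exp (- a)" by (simp flip: exp_add)
      moreover have "1 / (1 + a) \<le> 1" "0 \<le> 1 / (1 + K)" using \<open>0 \<le> a\<close> assms by simp_all
      ultimately show ?thesis by linarith
    next
      case False
      then have "1 / (1 + a) \<le> 1 / (1 + K)" using assms by (simp add: frac_le)
      moreover have "0 \<le> exp K * exp (- a)" by simp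
      ultimately show ?thesis by linarith
    qed
    from mult_left_mono[OF this, of "(ip S f u)\<^sup>2"] show ?thesis
      by (simp add: a_def algebra_simps)
  qed
  then have "resolvent_form t f \<le>
      (\<Sum>u\<in>B. exp K * ((ip S f u)\<^sup>2 * exp (t * \<nu> u)) + (ip S f u)\<^sup>2 / (1 + K))"
    unfolding resolvent_form_def by (rule sum_mono)
  also have "\<dots> = exp K * (\<Sum>x\<in>S. \<Sum>y\<in>S. f x * f y * transition_prob Q t x y) + ip S f f / (1 + K)"
    by (simp add: semigroup_form_spectral parseval[of f f] sum.distrib sum_distrib_left
        sum_divide_distrib power2_eq_square)
  finally show ?thesis .
qed

lemma mean_square_increment_ge:
  assumes "0 \<le> t"
  shows "2 * (ip S f f - resolvent_form t f) \<le> (\<Sum>x\<in>S. \<Sum>y\<in>S. (f x - f y)\<^sup>2 * transition_prob Q t x y)"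
  using semigroup_form_le_resolvent_form[OF assms, of f]
  unfolding mean_square_increment semigroup_form_spectral parseval[of f f]
  by (simp add: algebra_simps sum_subtractf power2_eq_square)

text \<open>The constant 4 is the 2 of \<open>mean_square_increment\<close> times the 2 lost in
  passing from \<open>1 - exp (- a)\<close> to \<open>1 - 1 / (1 + a)\<close>.\<close>

lemma mean_square_increment_le:
  assumes "0 \<le> t"
  shows "(\<Sum>x\<in>S. \<Sum>y\<in>S. (f x - f y)\<^sup>2 * transition_prob Q t x y) \<le> 4 * (ip S f f - resolvent_form t f)"
proof -
  have "(ip S f u)\<^sup>2 * (1 - exp (t * \<nu> u)) \<le> 2 * ((ip S f u)\<^sup>2 - (ip S f u)\<^sup>2 / (1 - t * \<nu> u))"
    if "u \<in> B" for u
  proof -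
    define a where "a = - (t * \<nu> u)"
    have "0 \<le> a" using nonpos[OF that] assms(1) by (simp add: a_def mult_nonneg_nonpos)
    have "1 - exp (- a) \<le> 2 * (1 - 1 / (1 + a))"
    \<comment> \<open>The right side is \<open>2 * a / (1 + a)\<close>: for \<open>a \<le> 1\<close>
      it is at least \<open>a\<close>, which dominates \<open>1 - exp (- a)\<close>; for larger
      \<open>a\<close> it exceeds 1.\<close>
    proof (cases "a \<le> 1")
      case True
      have "1 - exp (- a) \<le> a" using exp_ge_add_one_self[of "- a"] by simp
      also have "a * (1 + a) \<le> 2 * a" using True \<open>0 \<le> a\<close> by (simp add: algebra_simps mult_left_le)
      then have "a \<le> 2 * (1 - 1 / (1 + a))" using \<open>0 \<le> a\<close> by (simp add: field_simps)
      finally show ?thesis .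
    next
      case False
      then have "1 \<le> 2 * (1 - 1 / (1 + a))" by (simp add: field_simps)
      moreover have "0 \<le> exp (- a)" by simp
      ultimately show ?thesis by linarith
    qed
    from mult_left_mono[OF this, of "(ip S f u)\<^sup>2"] show ?thesis
      by (simp add: a_def algebra_simps)
  qed
  then have "(\<Sum>u\<in>B. (ip S f u)\<^sup>2 * (1 - exp (t * \<nu> u))) \<le>
      (\<Sum>u\<in>B. 2 * ((ip S f u)\<^sup>2 - (ip S f u)\<^sup>2 / (1 - t * \<nu> u)))"
    by (rule sum_mono)
  also have "\<dots> = 2 * (ip S f f - resolvent_form t f)"
    by (simp only: parseval[of f f] resolvent_form_def sum_distrib_left[symmetric] sum_subtractf power2_eq_square)
  finally show ?thesis unfolding mean_square_increment by simp
qed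

end

text \<open>Both resolvent forms are maxima of the variational functional, which is monotone in the
  operator.\<close>

lemma resolvent_form_mono:
  assumes "diagonalised_generator S Q q B \<nu>" "diagonalised_generator S Q' q' B' \<nu>'"
    and "\<And>h. ip S h (Q h) \<le> ip S h (Q' h)" "0 \<le> t"
  shows "diagonalised_generator.resolvent_form S B \<nu> t f \<le> diagonalised_generator.resolvent_form S B' \<nu>' t f"
proof -
  interpret D: diagonalised_generator S Q q B \<nu> by fact
  interpret D': diagonalised_generator S Q' q' B' \<nu>' by fact
  obtain h where "D.resolvent_form t f = 2 * ip S f h - ip S h h + t * ip S h (Q h)"
    using D.resolvent_form_attained[OF assms(4)] .
  also have "\<dots> \<le> 2 * ip S f h - ip S h h + t * ip S h (Q' h)"
    using assms(3,4) by (simp add: mult_left_mono)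
  also have "\<dots> \<le> D'.resolvent_form t f"
    by (rule D'.resolvent_form_ge[OF assms(4)])
  finally show ?thesis .
qed

text \<open>Each eigenvalue is the quadratic form at a unit eigenvector, so semidefiniteness gives
  its sign.\<close>

lemma (in symmetric_kernel_operator) exists_diagonalised_generator:
  assumes "\<And>f. ip S f (Q f) \<le> 0" "\<And>x. x \<in> S \<Longrightarrow> Q (\<lambda>_. 1) x = 0"
  obtains B \<nu> where "diagonalised_generator S Q q B \<nu>"
proof -
  obtain B \<nu> where B: "orthonormal S B" "\<And>u x. u \<in> B \<Longrightarrow> x \<in> S \<Longrightarrow> Q u x = \<nu> u * u x"
    "\<And>f x. x \<in> S \<Longrightarrow> f x = (\<Sum>u\<in>B. ip S f u * u x)"
    by (rule spectral_theorem) (rule that)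
  have "\<nu> u \<le> 0" if "u \<in> B" for u
  proof -
    have "ip S u (Q u) = ip S u (\<lambda>x. \<nu> u * u x)"
      using B(2)[OF that] by (intro ip_cong) auto
    also have "\<dots> = \<nu> u"
      using B(1) that by (simp add: ip_scale orthonormal_def)
    finally show ?thesis using assms(1)[of u] by simp
  qed
  then have "diagonalised_generator S Q q B \<nu>"
    using B assms by unfold_locales auto
  then show thesis using that by blast
qed

section \<open>The exclusion process\<close>

lemma sum_indicator_singleton:
  fixes f :: "'a \<Rightarrow> real"
  assumes "finite S" "z \<in> S"
  shows "(\<Sum>y\<in>S. indicator {y} z * f y) = f z"
proof -
  have "(\<Sum>y\<in>S. indicator {y} z * f y) = (\<Sum>y\<in>S. if y = z then f y else 0)"
    by (intro sum.cong) (auto simp: indicator_def)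
  then show ?thesis using assms by simp
qed

lemma finite_configs: "finite V \<Longrightarrow> finite (configs V)"
  by (simp add: configs_def finite_PiE)

lemma configs_nonempty: "configs V \<noteq> {}"
  by (auto simp: configs_def PiE_eq_empty_iff)

lemma swap_edge_involution: "card e = 2 \<Longrightarrow> swap_edge e (swap_edge e x) = x"
  by (auto simp: card_2_iff swap_edge_eq_transpose comp_assoc)

lemma swap_edge_configs:
  assumes "x \<in> configs V" "e \<subseteq> V" "card e = 2"
  shows "swap_edge e x \<in> configs V"
proof -
  obtain u v where e: "e = {u, v}" "u \<noteq> v" using assms(3) by (auto simp: card_2_iff)
  show ?thesis
    using assms(1,2) unfolding e(1) swap_edge_eq_transpose[OF e(2)] configs_def
    by (auto simp: PiE_iff extensional_def Transposition.transpose_def)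
qed

text \<open>A swap is an involution of the configurations; this is invariance of the uniform
  measure.\<close>

lemma sum_configs_swap_edge:
  assumes "e \<subseteq> V" "card e = 2"
  shows "(\<Sum>x\<in>configs V. g (swap_edge e x)) = (\<Sum>x\<in>configs V. g x)"
  by (rule sum.reindex_bij_witness[of _ "swap_edge e" "swap_edge e"])
    (use assms in \<open>auto simp: swap_edge_involution swap_edge_configs\<close>)

text \<open>For each edge, swap invariance equates the sums of the two squares, which turns the
  cross term into half of a squared difference.\<close>

lemma exclusion_dirichlet_form:
  assumes "E \<subseteq> {e. e \<subseteq> V \<and> card e = 2}"
  shows "ip (configs V) f (exclusion_generator E \<alpha> f) =
    - (\<alpha> / 2) * (\<Sum>e\<in>E. \<Sum>x\<in>configs V. (f (swap_edge e x) - f x)\<^sup>2)"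
proof -
  have edge: "(\<Sum>x\<in>configs V. f x * (f (swap_edge e x) - f x)) =
      - (1 / 2) * (\<Sum>x\<in>configs V. (f (swap_edge e x) - f x)\<^sup>2)" if "e \<in> E" for e
  proof -
    have "(\<Sum>x\<in>configs V. (f (swap_edge e x) - f x)\<^sup>2) =
        (\<Sum>x\<in>configs V. (f (swap_edge e x))\<^sup>2) + (\<Sum>x\<in>configs V. (f x)\<^sup>2)
          - 2 * (\<Sum>x\<in>configs V. f x * f (swap_edge e x))"
      by (simp add: power2_diff sum.distrib sum_subtractf sum_distrib_left mult_ac)
    also have "(\<Sum>x\<in>configs V. (f (swap_edge e x))\<^sup>2) = (\<Sum>x\<in>configs V. (f x)\<^sup>2)"
      using that assms by (intro sum_configs_swap_edge) auto
    finally show ?thesis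
      by (simp add: right_diff_distrib sum_subtractf power2_eq_square)
  qed
  have "ip (configs V) f (exclusion_generator E \<alpha> f) =
      \<alpha> * (\<Sum>e\<in>E. \<Sum>x\<in>configs V. f x * (f (swap_edge e x) - f x))"
    unfolding ip_def exclusion_generator_def sum.swap[of _ "configs V" E]
    by (simp add: sum_distrib_left mult_ac)
  then show ?thesis by (simp add: edge sum_negf sum_distrib_left)
qed

text \<open>The kernel is the matrix of the generator. It is symmetric because a swap taking
  \<open>x\<close> to \<open>y\<close> also takes \<open>y\<close> to \<open>x\<close>.\<close>

lemma exclusion_symmetric_kernel_operator:
  fixes V :: "'v set"
  assumes "finite V" "E \<subseteq> {e. e \<subseteq> V \<and> card e = 2}"
  shows "symmetric_kernel_operator (configs V) (exclusion_generator E \<alpha>)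
    (\<lambda>x y. exclusion_generator E \<alpha> (indicator {y}) x)"
proof
  show "finite (configs V)" using assms finite_configs by blast
next
  fix x and f :: "('v \<Rightarrow> nat) \<Rightarrow> real" assume x: "x \<in> configs V"
  have delta: "(\<Sum>y\<in>configs V. indicator {y} z * f y) = f z" if "z \<in> configs V" for z
    using sum_indicator_singleton[OF finite_configs[OF assms(1)] that] .
  have swap: "swap_edge e x \<in> configs V" if "e \<in> E" for e
    using that assms(2) by (intro swap_edge_configs[OF x]) auto
  have "(\<Sum>y\<in>configs V. exclusion_generator E \<alpha> (indicator {y}) x * f y) =
      \<alpha> * (\<Sum>e\<in>E. \<Sum>y\<in>configs V. indicator {y} (swap_edge e x) * f y - indicator {y} x * f y)"
    unfolding exclusion_generator_def
    by (subst sum.swap) (simp add: sum_distrib_left sum_distrib_right algebra_simps)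
  also have "\<dots> = exclusion_generator E \<alpha> f x"
    unfolding sum_subtractf exclusion_generator_def
    by (simp add: delta[OF x] delta[OF swap])
  finally show "exclusion_generator E \<alpha> f x =
      (\<Sum>y\<in>configs V. exclusion_generator E \<alpha> (indicator {y}) x * f y)" ..
next
  fix x y
  have "swap_edge e x = y \<longleftrightarrow> swap_edge e y = x" if "e \<in> E" for e
    using that assms(2) swap_edge_involution[of e] by blast
  then show "exclusion_generator E \<alpha> (indicator {y}) x = exclusion_generator E \<alpha> (indicator {x}) y"
    unfolding exclusion_generator_def
    by (intro arg_cong[of _ _ "\<lambda>s. \<alpha> * s"] sum.cong) (auto simp: indicator_def)
qed

lemma exclusion_diagonalised_generator:
  assumes "finite V" "E \<subseteq> {e. e \<subseteq> V \<and> card e = 2}" "0 < \<alpha>"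
  obtains B \<nu> where "diagonalised_generator (configs V) (exclusion_generator E \<alpha>)
    (\<lambda>x y. exclusion_generator E \<alpha> (indicator {y}) x) B \<nu>"
proof -
  have "ip (configs V) f (exclusion_generator E \<alpha> f) \<le> 0" for f
    unfolding exclusion_dirichlet_form[OF assms(2)] using assms(3)
    by (simp add: sum_nonneg)
  moreover have "exclusion_generator E \<alpha> (\<lambda>_. 1) x = 0" for x
    by (simp add: exclusion_generator_def)
  ultimately show thesis
    using symmetric_kernel_operator.exists_diagonalised_generator
      [OF exclusion_symmetric_kernel_operator[OF assms(1,2)]] that by metis
qed

text \<open>Removing edges drops nonnegative terms from the Dirichlet sum, and the minus sign in
  front reverses the inequality.\<close>

lemma exclusion_dirichlet_form_mono:
  assumes "finite V" "E \<subseteq> {e. e \<subseteq> V \<and> card e = 2}" "E' \<subseteq> E" "0 < \<alpha>"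
  shows "ip (configs V) h (exclusion_generator E \<alpha> h) \<le> ip (configs V) h (exclusion_generator E' \<alpha> h)"
proof -
  have "finite E" by (rule finite_subset[of _ "Pow V"]) (use assms in auto)
  then have "(\<Sum>e\<in>E'. \<Sum>x\<in>configs V. (h (swap_edge e x) - h x)\<^sup>2) \<le>
      (\<Sum>e\<in>E. \<Sum>x\<in>configs V. (h (swap_edge e x) - h x)\<^sup>2)"
    using assms(3) by (intro sum_mono2) (auto intro: sum_nonneg)
  then show ?thesis
    using exclusion_dirichlet_form[of E V h \<alpha>] exclusion_dirichlet_form[of E' V h \<alpha>] assms
    by auto
qed

section \<open>Two-time expectations, covariance and disagreement as finite sums\<close>

lemma expectation_two_times:
  assumes chain: "markov_chain_with_generator M X S Q"
    and init: "distr M (count_space S) (X 0) = uniform_count_measure S"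
    and "finite S" "0 \<le> t"
  shows "(\<integral>\<omega>. F (X 0 \<omega>) (X t \<omega>) \<partial>M) = (\<Sum>x\<in>S. \<Sum>y\<in>S. F x y * transition_prob Q t x y) / real (card S)"
proof -
  have M: "prob_space M" and X: "\<And>t. 0 \<le> t \<Longrightarrow> X t \<in> measurable M (count_space S)"
    using chain by (auto simp: markov_chain_with_generator_def)
  interpret prob_space M by fact
  define A where "A x y = {\<omega>\<in>space M. X 0 \<omega> = x \<and> X t \<omega> = y}" for x y
  have A_sets: "A x y \<in> sets M" if "x \<in> S" "y \<in> S" for x y
  proof -
    have "A x y = (X 0 -` {x} \<inter> space M) \<inter> (X t -` {y} \<inter> space M)"
      by (auto simp: A_def)
    then show ?thesis
      using measurable_sets[OF X[of 0], of "{x}"] measurable_sets[OF X[of t], of "{y}"] that assms(4)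
      by simp
  qed
  have measure_A: "measure M (A x y) = transition_prob Q t x y / card S" if "x \<in> S" "y \<in> S" for x y
  proof -
    \<comment> \<open>The Markov property is instantiated with \<open>m = 0\<close>: times 0 and
      \<open>t\<close>, states \<open>x\<close> and \<open>y\<close>.\<close>
    define s :: "nat \<Rightarrow> real" where "s i = (if i = 0 then 0 else t)" for i
    define z where "z i = (if i = 0 then x else y)" for i :: nat
    have two: "(\<forall>i\<le>Suc 0. P i) \<longleftrightarrow> P 0 \<and> P (Suc 0)" for P
      by (auto simp: le_Suc_eq)
    have "\<forall>m (t :: nat \<Rightarrow> real) x. 0 \<le> t 0 \<and> (\<forall>i\<le>m. t i \<le> t (Suc i)) \<and> (\<forall>i\<le>Suc m. x i \<in> S) \<longrightarrow>
        measure M {\<omega>\<in>space M. \<forall>i\<le>Suc m. X (t i) \<omega> = x i} =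
        measure M {\<omega>\<in>space M. \<forall>i\<le>m. X (t i) \<omega> = x i} *
          transition_prob Q (t (Suc m) - t m) (x m) (x (Suc m))"
      using chain by (simp add: markov_chain_with_generator_def)
    from this[rule_format, of s 0 z]
    have "measure M (A x y) = measure M {\<omega>\<in>space M. X 0 \<omega> = x} * transition_prob Q t x y"
      using that assms(4) by (simp add: two A_def s_def z_def)
    moreover have "measure M {\<omega>\<in>space M. X 0 \<omega> = x} = 1 / card S"
    proof -
      have "measure (distr M (count_space S) (X 0)) {x} = measure M (X 0 -` {x} \<inter> space M)"
        using X[of 0] that by (intro measure_distr) auto
      moreover have "X 0 -` {x} \<inter> space M = {\<omega>\<in>space M. X 0 \<omega> = x}" by auto
      ultimately show ?thesis
        using that assms(3) by (simp add: init measure_uniform_count_measure)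
    qed
    ultimately show ?thesis by simp
  qed
  have "(\<integral>\<omega>. F (X 0 \<omega>) (X t \<omega>) \<partial>M) = (\<integral>\<omega>. (\<Sum>x\<in>S. \<Sum>y\<in>S. F x y * indicator (A x y) \<omega>) \<partial>M)"
  proof (rule Bochner_Integration.integral_cong[OF refl])
    fix \<omega> assume \<omega>: "\<omega> \<in> space M"
    have "X 0 \<omega> \<in> S" "X t \<omega> \<in> S"
      using measurable_space[OF X \<omega>] assms(4) by auto
    then have "F (X 0 \<omega>) (X t \<omega>) =
        (\<Sum>x\<in>S. indicator {x} (X 0 \<omega>) * (\<Sum>y\<in>S. indicator {y} (X t \<omega>) * F x y))"
      by (simp only: sum_indicator_singleton[OF \<open>finite S\<close>])
    also have "\<dots> = (\<Sum>x\<in>S. \<Sum>y\<in>S. F x y * indicator (A x y) \<omega>)"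
      unfolding sum_distrib_left using \<omega> by (intro sum.cong) (auto simp: A_def indicator_def)
    finally show "F (X 0 \<omega>) (X t \<omega>) = (\<Sum>x\<in>S. \<Sum>y\<in>S. F x y * indicator (A x y) \<omega>)" .
  qed
  also have "\<dots> = (\<Sum>x\<in>S. \<Sum>y\<in>S. F x y * measure M (A x y))"
  proof -
    have int: "integrable M (\<lambda>\<omega>. F x y * indicator (A x y) \<omega>)" if "x \<in> S" "y \<in> S" for x y
      using A_sets[OF that] by (intro integrable_mult_right integrable_real_indicator) (simp_all add: emeasure_eq_measure)
    have "A x y \<inter> space M = A x y" for x y
      by (auto simp: A_def)
    then show ?thesis
      using int by (simp add: Bochner_Integration.integral_sum)
  qed
  also have "\<dots> = (\<Sum>x\<in>S. \<Sum>y\<in>S. F x y * transition_prob Q t x y) / card S"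
    by (simp add: measure_A sum_divide_distrib)
  finally show ?thesis .
qed

text \<open>Column sums equal to 1 make the uniform law stationary, so both times have the same mean
  \<open>m\<close> and the covariance is the semigroup form of the centred function.\<close>

lemma covariance_exclusion:
  fixes f :: "('v \<Rightarrow> nat) \<Rightarrow> real"
  assumes sep: "symmetric_exclusion_process M X V E \<alpha>"
    and diag: "diagonalised_generator (configs V) (exclusion_generator E \<alpha>) q B \<nu>"
    and "0 \<le> t"
  defines "m \<equiv> (\<Sum>x\<in>configs V. f x) / card (configs V)"
  shows "covariance M (\<lambda>\<omega>. f (X 0 \<omega>)) (\<lambda>\<omega>. f (X t \<omega>)) =
    (\<Sum>x\<in>configs V. \<Sum>y\<in>configs V.
      (f x - m) * (f y - m) * transition_prob (exclusion_generator E \<alpha>) t x y) / card (configs V)"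
proof -
  interpret diagonalised_generator "configs V" "exclusion_generator E \<alpha>" q B \<nu> by fact
  note two = expectation_two_times[OF sep[unfolded symmetric_exclusion_process_def, THEN conjunct1]
      sep[unfolded symmetric_exclusion_process_def, THEN conjunct2] finite_S \<open>0 \<le> t\<close>]
  have "(\<integral>\<omega>. f (X 0 \<omega>) \<partial>M) = m"
    using two[of "\<lambda>x y. f x"]
    by (simp add: m_def transition_prob_row_sum flip: sum_distrib_left)
  moreover have "(\<integral>\<omega>. f (X t \<omega>) \<partial>M) = m"
    using two[of "\<lambda>x y. f y"] sum.swap[of "\<lambda>x y. f y * transition_prob (exclusion_generator E \<alpha>) t x y"]
    by (simp add: m_def transition_prob_column_sum flip: sum_distrib_left)
  ultimately show ?thesis
    using two[of "\<lambda>x y. (f x - m) * (f y - m)"] by (simp add: covariance_def)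
qed

text \<open>For values in {0, 1} the indicator of disagreement is the squared difference.\<close>

lemma disagreement_probability_exclusion:
  assumes sep: "symmetric_exclusion_process M X V E \<alpha>"
    and "finite V" "0 \<le> t" and f: "f \<in> configs V \<rightarrow> {0, 1}"
  shows "measure M {\<omega>\<in>space M. f (X 0 \<omega>) \<noteq> f (X t \<omega>)} =
    (\<Sum>x\<in>configs V. \<Sum>y\<in>configs V.
      (f x - f y)\<^sup>2 * transition_prob (exclusion_generator E \<alpha>) t x y) / card (configs V)"
proof -
  have chain: "markov_chain_with_generator M X (configs V) (exclusion_generator E \<alpha>)"
    and init: "distr M (count_space (configs V)) (X 0) = uniform_count_measure (configs V)"
    using sep by (auto simp: symmetric_exclusion_process_def)
  have X: "X s \<omega> \<in> configs V" if "0 \<le> s" "\<omega> \<in> space M" for s \<omega>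
    using chain that measurable_space[of "X s" M "count_space (configs V)" \<omega>]
    by (auto simp: markov_chain_with_generator_def)
  have "measure M {\<omega>\<in>space M. f (X 0 \<omega>) \<noteq> f (X t \<omega>)} =
      (\<integral>\<omega>. indicator {\<omega>\<in>space M. f (X 0 \<omega>) \<noteq> f (X t \<omega>)} \<omega> \<partial>M)"
    by (simp add: Int_def cong: conj_cong)
  also have "\<dots> = (\<integral>\<omega>. (f (X 0 \<omega>) - f (X t \<omega>))\<^sup>2 \<partial>M)"
  proof (rule Bochner_Integration.integral_cong[OF refl])
    fix \<omega> assume \<omega>: "\<omega> \<in> space M"
    have "f (X 0 \<omega>) \<in> {0, 1}" "f (X t \<omega>) \<in> {0, 1}"
      using f X[OF _ \<omega>] \<open>0 \<le> t\<close> by blast+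
    then show "indicator {\<omega>\<in>space M. f (X 0 \<omega>) \<noteq> f (X t \<omega>)} \<omega> = (f (X 0 \<omega>) - f (X t \<omega>))\<^sup>2"
      using \<omega> by auto
  qed
  also have "\<dots> = (\<Sum>x\<in>configs V. \<Sum>y\<in>configs V.
      (f x - f y)\<^sup>2 * transition_prob (exclusion_generator E \<alpha>) t x y) / card (configs V)"
    using expectation_two_times[OF chain init finite_configs[OF \<open>finite V\<close>] \<open>0 \<le> t\<close>,
        of "\<lambda>x y. (f x - f y)\<^sup>2"] .
  finally show ?thesis .
qed

text \<open>Each bound passes from one semigroup to its resolvent, changes the graph there, and
  returns to the other semigroup. None of the constants depends on the graph or on
  \<open>t\<close>.\<close>

lemma exclusion_comparison:
  assumes V: "finite V" and E: "E \<subseteq> {e. e \<subseteq> V \<and> card e = 2}" and sub: "E' \<subseteq> E" and \<alpha>: "0 < \<alpha>"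
    and f: "f \<in> configs V \<rightarrow> {0, 1}"
    and sep: "symmetric_exclusion_process M X V E \<alpha>"
    and sep': "symmetric_exclusion_process M' X' V E' \<alpha>"
    and t: "0 \<le> t"
  shows covariance_nonneg: "0 \<le> covariance M (\<lambda>\<omega>. f (X 0 \<omega>)) (\<lambda>\<omega>. f (X t \<omega>))"
    and covariance_comparison: "0 \<le> K \<Longrightarrow> covariance M (\<lambda>\<omega>. f (X 0 \<omega>)) (\<lambda>\<omega>. f (X t \<omega>)) \<le>
      exp K * covariance M' (\<lambda>\<omega>. f (X' 0 \<omega>)) (\<lambda>\<omega>. f (X' t \<omega>)) + 1 / (1 + K)"
    and disagreement_comparison: "measure M' {\<omega>\<in>space M'. f (X' 0 \<omega>) \<noteq> f (X' t \<omega>)} \<le>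
      2 * measure M {\<omega>\<in>space M. f (X 0 \<omega>) \<noteq> f (X t \<omega>)}"
proof -
  define S where "S = configs V"
  define N where "N = real (card S)"
  have "finite S" unfolding S_def by (rule finite_configs[OF V])
  then have "0 < N" using configs_nonempty[of V] by (simp add: N_def S_def card_gt_0_iff)
  define m where "m = (\<Sum>x\<in>S. f x) / N"
  define g where "g x = f x - m" for x
  have E': "E' \<subseteq> {e. e \<subseteq> V \<and> card e = 2}" using E sub by blast
  obtain B \<nu> where D: "diagonalised_generator S (exclusion_generator E \<alpha>)
      (\<lambda>x y. exclusion_generator E \<alpha> (indicator {y}) x) B \<nu>"
    unfolding S_def using exclusion_diagonalised_generator[OF V E \<alpha>] .
  obtain B' \<nu>' where D': "diagonalised_generator S (exclusion_generator E' \<alpha>)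
      (\<lambda>x y. exclusion_generator E' \<alpha> (indicator {y}) x) B' \<nu>'"
    unfolding S_def using exclusion_diagonalised_generator[OF V E' \<alpha>] .
  interpret D: diagonalised_generator S "exclusion_generator E \<alpha>"
      "\<lambda>x y. exclusion_generator E \<alpha> (indicator {y}) x" B \<nu> by fact
  interpret D': diagonalised_generator S "exclusion_generator E' \<alpha>"
      "\<lambda>x y. exclusion_generator E' \<alpha> (indicator {y}) x" B' \<nu>' by fact
  let ?C = "\<Sum>x\<in>S. \<Sum>y\<in>S. g x * g y * transition_prob (exclusion_generator E \<alpha>) t x y"
  let ?C' = "\<Sum>x\<in>S. \<Sum>y\<in>S. g x * g y * transition_prob (exclusion_generator E' \<alpha>) t x y"
  have mono: "D.resolvent_form t h \<le> D'.resolvent_form t h" for h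
    using exclusion_dirichlet_form_mono[OF V E sub \<alpha>]
    by (intro resolvent_form_mono[OF D D' _ t]) (simp add: S_def)
  have cov: "covariance M (\<lambda>\<omega>. f (X 0 \<omega>)) (\<lambda>\<omega>. f (X t \<omega>)) = ?C / N"
    using covariance_exclusion[OF sep D[unfolded S_def] t]
    by (simp add: S_def N_def g_def m_def)
  have cov': "covariance M' (\<lambda>\<omega>. f (X' 0 \<omega>)) (\<lambda>\<omega>. f (X' t \<omega>)) = ?C' / N"
    using covariance_exclusion[OF sep' D'[unfolded S_def] t]
    by (simp add: S_def N_def g_def m_def)
  show "0 \<le> covariance M (\<lambda>\<omega>. f (X 0 \<omega>)) (\<lambda>\<omega>. f (X t \<omega>))"
    unfolding cov using D.semigroup_form_nonneg \<open>0 < N\<close> by simp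
  \<comment> \<open>This bound cancels the normalisation by \<open>N\<close>, leaving the error
    \<open>1 / (1 + K)\<close> free of the graph.\<close>
  have ip_g: "ip S g g \<le> N"
  proof -
    have f01: "0 \<le> f x" "f x \<le> 1" if "x \<in> S" for x
      using f that by (auto simp: S_def Pi_def)
    then have "(\<Sum>x\<in>S. f x) \<le> N" using sum_bounded_above[of S f 1] by (simp add: N_def)
    then have m: "0 \<le> m" "m \<le> 1"
      using \<open>0 < N\<close> f01 by (auto simp: m_def intro!: sum_nonneg divide_nonneg_pos)
    have "g x * g x \<le> 1" if "x \<in> S" for x
    proof -
      have "\<bar>g x\<bar> \<le> 1" using f01[OF that] m by (simp add: g_def abs_le_iff)
      then show ?thesis by (simp add: abs_square_le_1 flip: power2_eq_square)
    qed
    then show ?thesis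
      using sum_bounded_above[of S "\<lambda>x. g x * g x" 1] by (simp add: ip_def N_def)
  qed
  show "covariance M (\<lambda>\<omega>. f (X 0 \<omega>)) (\<lambda>\<omega>. f (X t \<omega>)) \<le>
      exp K * covariance M' (\<lambda>\<omega>. f (X' 0 \<omega>)) (\<lambda>\<omega>. f (X' t \<omega>)) + 1 / (1 + K)" if "0 \<le> K"
  proof -
    have "?C \<le> D.resolvent_form t g"
      by (rule D.semigroup_form_le_resolvent_form[OF t])
    also have "\<dots> \<le> D'.resolvent_form t g" by (rule mono)
    also have "\<dots> \<le> exp K * ?C' + ip S g g / (1 + K)"
      by (rule D'.resolvent_form_le_semigroup_form[OF t that])
    also have "\<dots> \<le> exp K * ?C' + N / (1 + K)"
      using ip_g that by (simp add: divide_right_mono)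
    finally have "?C / N \<le> (exp K * ?C' + N / (1 + K)) / N"
      using \<open>0 < N\<close> by (simp add: divide_right_mono)
    then show ?thesis unfolding cov cov' using \<open>0 < N\<close> by (simp add: add_divide_distrib)
  qed
  show "measure M' {\<omega>\<in>space M'. f (X' 0 \<omega>) \<noteq> f (X' t \<omega>)} \<le>
      2 * measure M {\<omega>\<in>space M. f (X 0 \<omega>) \<noteq> f (X t \<omega>)}"
  proof -
    let ?I = "\<Sum>x\<in>S. \<Sum>y\<in>S. (f x - f y)\<^sup>2 * transition_prob (exclusion_generator E \<alpha>) t x y"
    let ?I' = "\<Sum>x\<in>S. \<Sum>y\<in>S. (f x - f y)\<^sup>2 * transition_prob (exclusion_generator E' \<alpha>) t x y"
    \<comment> \<open>Increments ignore constants, so \<open>f\<close> is used uncentred. The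
      factors 4 for \<open>E'\<close> and 2 for \<open>E\<close> leave the ratio 2.\<close>
    have "?I' \<le> 4 * (ip S f f - D'.resolvent_form t f)"
      by (rule D'.mean_square_increment_le[OF t])
    also have "\<dots> \<le> 2 * (2 * (ip S f f - D.resolvent_form t f))"
      using mono[of f] by simp
    also have "\<dots> \<le> 2 * ?I"
      by (intro mult_left_mono D.mean_square_increment_ge[OF t]) simp
    finally have "?I' / N \<le> 2 * (?I / N)"
      using \<open>0 < N\<close> by (simp add: divide_right_mono)
    then show ?thesis
      unfolding disagreement_probability_exclusion[OF sep V t f]
        disagreement_probability_exclusion[OF sep' V t f] by (simp add: S_def N_def)
  qed
qed

section \<open>Passage to the limit along the sequence of graphs\<close>

theorem theorem1p5:
  fixes V :: "nat \<Rightarrow> 'v set" and E E' :: "nat \<Rightarrow> 'v set set" and \<alpha> :: "nat \<Rightarrow> real"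
    and f :: "nat \<Rightarrow> ('v \<Rightarrow> nat) \<Rightarrow> real"
    and M :: "nat \<Rightarrow> 'a measure" and X :: "nat \<Rightarrow> real \<Rightarrow> 'a \<Rightarrow> 'v \<Rightarrow> nat"
    and M' :: "nat \<Rightarrow> 'b measure" and X' :: "nat \<Rightarrow> real \<Rightarrow> 'b \<Rightarrow> 'v \<Rightarrow> nat"
  assumes "\<And>n. n \<ge> 1 \<Longrightarrow> finite_connected_graph (V n) (E n)"
    and "\<And>n. n \<ge> 1 \<Longrightarrow> finite_connected_graph (V n) (E' n)"
    and "\<And>n. n \<ge> 1 \<Longrightarrow> E' n \<subseteq> E n"
    and "\<And>n. n \<ge> 1 \<Longrightarrow> \<alpha> n > 0"
    and "\<And>n. n \<ge> 1 \<Longrightarrow> f n \<in> configs (V n) \<rightarrow> {0, 1}"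
    and "\<And>n. n \<ge> 1 \<Longrightarrow> symmetric_exclusion_process (M n) (X n) (V n) (E n) (\<alpha> n)"
    and "\<And>n. n \<ge> 1 \<Longrightarrow> symmetric_exclusion_process (M' n) (X' n) (V n) (E' n) (\<alpha> n)"
    and "nondegenerate M X f"
  shows "(exclusion_sensitive M' X' f \<longrightarrow> exclusion_sensitive M X f) \<and>
         (exclusion_stable M X f \<longrightarrow> exclusion_stable M' X' f)"
proof (intro conjI impI)
  have fin: "finite (V n)" "E n \<subseteq> {e. e \<subseteq> V n \<and> card e = 2}" if "n \<ge> 1" for n
    using assms(1)[OF that] by (auto simp: finite_connected_graph_def)
  {
    define C where "C n = covariance (M n) (\<lambda>\<omega>. f n (X n 0 \<omega>)) (\<lambda>\<omega>. f n (X n 1 \<omega>))" for n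
    define C' where "C' n = covariance (M' n) (\<lambda>\<omega>. f n (X' n 0 \<omega>)) (\<lambda>\<omega>. f n (X' n 1 \<omega>))" for n
    have C_nonneg: "0 \<le> C n" if "n \<ge> 1" for n
      unfolding C_def
      using covariance_nonneg[OF fin[OF that] assms(3-7)[OF that]] by simp
    have C_le: "C n \<le> exp K * C' n + 1 / (1 + K)" if "n \<ge> 1" "0 \<le> K" for n K
      unfolding C_def C'_def
      using covariance_comparison[OF fin[OF that(1)] assms(3-7)[OF that(1)] _ that(2)] by simp
    assume "exclusion_sensitive M' X' f"
    then have C': "C' \<longlonglongrightarrow> 0" by (simp add: exclusion_sensitive_def C'_def[abs_def])
    have "C \<longlonglongrightarrow> 0"
    proof (rule tendstoI)
      fix r :: real assume "0 < r"
      \<comment> \<open>With this choice \<open>1 / (1 + K)\<close> is \<open>r / (r + 2)\<close>,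
        below \<open>r / 2\<close>. As \<open>K\<close> is fixed before \<open>n\<close> varies,
        \<open>exp K\<close> is a constant factor on a null sequence.\<close>
      define K where "K = 2 / r"
      have "0 \<le> K" "1 / (1 + K) < r / 2" using \<open>0 < r\<close> by (simp_all add: K_def field_simps)
      have "\<forall>\<^sub>F n in sequentially. exp K * C' n < r / 2"
        using order_tendstoD(2)[OF tendsto_mult_right_zero[OF C', of "exp K"], of "r / 2"] \<open>0 < r\<close>
        by simp
      then show "\<forall>\<^sub>F n in sequentially. dist (C n) 0 < r"
        using eventually_ge_at_top[of 1]
      proof eventually_elim
        case (elim n)
        then show ?case
          using C_le[OF elim(2) \<open>0 \<le> K\<close>] C_nonneg[OF elim(2)] \<open>1 / (1 + K) < r / 2\<close> by simp
      qed
    qed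
    then show "exclusion_sensitive M X f" by (simp add: exclusion_sensitive_def C_def[abs_def])
  }
  {
    define P where "P \<epsilon> n = measure (M n) {\<omega>\<in>space (M n). f n (X n 0 \<omega>) \<noteq> f n (X n \<epsilon> \<omega>)}" for \<epsilon> n
    define P' where "P' \<epsilon> n = measure (M' n) {\<omega>\<in>space (M' n). f n (X' n 0 \<omega>) \<noteq> f n (X' n \<epsilon> \<omega>)}" for \<epsilon> n
    have P_le: "P' \<epsilon> n \<le> 2 * P \<epsilon> n" if "n \<ge> 1" "0 < \<epsilon>" for n \<epsilon>
      unfolding P_def P'_def
      using disagreement_comparison[OF fin[OF that(1)] assms(3-7)[OF that(1)]] that(2) by simp
    have lower: "0 \<le> limsup (\<lambda>n. ereal (P' \<epsilon> n))" for \<epsilon>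
      by (rule le_Limsup) (simp_all add: P'_def)
    have upper: "limsup (\<lambda>n. ereal (P' \<epsilon> n)) \<le> ereal 2 * limsup (\<lambda>n. ereal (P \<epsilon> n))" if "0 < \<epsilon>" for \<epsilon>
    proof -
      have "limsup (\<lambda>n. ereal (P' \<epsilon> n)) \<le> limsup (\<lambda>n. ereal 2 * ereal (P \<epsilon> n))"
        \<comment> \<open>The comparison holds from index 1 on, which suffices for the upper
          limit.\<close>
        by (rule Limsup_mono, rule eventually_sequentiallyI[of 1]) (use P_le that in simp)
      also have "\<dots> = ereal 2 * limsup (\<lambda>n. ereal (P \<epsilon> n))"
        by (rule Limsup_ereal_mult_left) simp_all
      finally show ?thesis .
    qed
    assume "exclusion_stable M X f"
    then have "((\<lambda>\<epsilon>. limsup (\<lambda>n. ereal (P \<epsilon> n))) \<longlongrightarrow> 0) (at_right 0)"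
      by (simp add: exclusion_stable_def P_def)
    then have "((\<lambda>\<epsilon>. ereal 2 * limsup (\<lambda>n. ereal (P \<epsilon> n))) \<longlongrightarrow> ereal 2 * 0) (at_right 0)"
      by (intro tendsto_cmult_ereal) simp_all
    then have "((\<lambda>\<epsilon>. ereal 2 * limsup (\<lambda>n. ereal (P \<epsilon> n))) \<longlongrightarrow> 0) (at_right 0)"
      by simp
    \<comment> \<open>Sandwich between 0 and twice the upper limit for \<open>E\<close>; the upper
      bound is available only for positive \<open>\<epsilon>\<close>, hence eventually at the right
      of 0.\<close>
    then have "((\<lambda>\<epsilon>. limsup (\<lambda>n. ereal (P' \<epsilon> n))) \<longlongrightarrow> 0) (at_right 0)"
      by (rule tendsto_sandwich[rotated -1, OF _ _ _ tendsto_const])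
        (use lower upper in \<open>auto simp: eventually_at_right_less intro: eventually_mono[OF eventually_at_right_less]\<close>)
    then show "exclusion_stable M' X' f" by (simp add: exclusion_stable_def P'_def)
  }
qed

end
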